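(* $\mathcal S_2=\{q^{-2}\}$, that is, $\mu(\Lambda)=q^{-2}$ for every $\Lambda\in\mathcal L_2$.
   Context: Let $q$ be a prime power, $\mathcal R=\mathbb F_q[x]$, and $\tilde{\mathcal K}=\mathbb F_q((x^{-1}))$, with the absolute value $|\cdot|$ extending $|f|=q^{\deg f}$ for nonzero $f\in\mathcal R$ (and $|0|=0$). $\mathcal L_d$ is the space of unimodular lattices in $\tilde{\mathcal K}^d$, i.e. sets $g\mathcal R^d$ with $g$ an invertible $d\times d$ matrix over $\tilde{\mathcal K}$ with $|\det(g)|=1$. Let $N(\mathbf v)=\prod_{i=1}^d|v_i|$ for $\mathbf v\in\tilde{\mathcal K}^d$, let $\mu(\Lambda)=\sup_{\mathbf v\in\tilde{\mathcal K}^d}\inf_{\mathbf u\in\Lambda}N(\mathbf v-\mathbf u)$ for $\Lambda\in\mathcal L_d$, and let the Minkowski spectrum be $\mathcal S_d=\{\mu(\Lambda):\Lambda\in\mathcal L_d\}$. *)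

theory Defs
  imports "HOL-Analysis.Analysis" "HOL-Computational_Algebra.Formal_Laurent_Series"
begin

text \<open>
  The finite field with q elements is an arbitrary type \<open>'a :: {field, finite}\<close>, with q = CARD('a).
  The field of Laurent series over it in 1/x is \<open>'a fls\<close>: the formal variable \<open>fls_X\<close>
  stands for 1/x, so that x itself is \<open>fls_X_inv\<close>.
\<close>

definition embed_poly :: "'a::{field,finite} poly \<Rightarrow> 'a fls" where
  "embed_poly p = poly (map_poly fls_const p) fls_X_inv"

text \<open>The subdegree is the order of vanishing in 1/x, i.e. minus the degree in x.\<close>

definition fls_abs :: "'a::{field,finite} fls \<Rightarrow> real" where
  "fls_abs f = (if f = 0 then 0 else real CARD('a) powi (- fls_subdegree f))"

lemma embed_poly_nth:
  "fls_nth (embed_poly p) k = (if k \<le> 0 then coeff p (nat (- k)) else 0)"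
proof -
  have deg: "degree (map_poly fls_const p) = degree p"
    by (rule degree_map_poly) auto
  have "embed_poly p = (\<Sum>i\<le>degree p. fls_const (coeff p i) * fls_X_inv ^ i)"
    by (simp add: embed_poly_def poly_altdef deg coeff_map_poly)
  then have "fls_nth (embed_poly p) k = (\<Sum>i\<le>degree p. if k = - int i then coeff p i else 0)"
    by (simp add: fls_nth_sum if_distrib cong: if_cong)
  also have "\<dots> = (\<Sum>i\<le>degree p. if k \<le> 0 \<and> i = nat (- k) then coeff p i else 0)"
    by (intro sum.cong) auto
  also have "\<dots> = (if k \<le> 0 then coeff p (nat (- k)) else 0)"
    by (auto simp: coeff_eq_0)
  finally show ?thesis .
qed

lemma fls_abs_embed_poly:
  fixes p :: "'a::{field,finite} poly"
  assumes "p \<noteq> 0"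
  shows "fls_abs (embed_poly p) = real CARD('a) ^ degree p"
proof -
  have "fls_nth (embed_poly p) (- int (degree p)) \<noteq> 0"
    using assms by (simp add: embed_poly_nth)
  moreover have "fls_subdegree (embed_poly p) = - int (degree p)"
    using assms by (intro fls_subdegree_eqI) (auto simp: embed_poly_nth coeff_eq_0)
  ultimately show ?thesis
    by (auto simp: fls_abs_def)
qed

text \<open>The set of vectors with polynomial entries.\<close>

definition poly_vectors :: "('a::{field,finite} fls ^ 'd::finite) set" where
  "poly_vectors = {w. \<forall>i. w $ i \<in> range embed_poly}"

definition unimodular_lattices :: "('a::{field,finite} fls ^ 'd::finite) set set" where
  "unimodular_lattices =
    {(\<lambda>w. g *v w) ` poly_vectors | g. invertible g \<and> fls_abs (det g) = 1}"

definition prod_norm :: "'a::{field,finite} fls ^ 'd::finite \<Rightarrow> real" where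
  "prod_norm v = (\<Prod>i\<in>UNIV. fls_abs (v $ i))"

text \<open>Extended reals, because nothing here ensures a priori that the supremum is finite.\<close>

definition minkowski_mu :: "('a::{field,finite} fls ^ 'd::finite) set \<Rightarrow> ereal" where
  "minkowski_mu \<Lambda> = (SUP v. INF u\<in>\<Lambda>. ereal (prod_norm (v - u)))"

text \<open>The type arguments carry the base field and the index type, CARD('d) being the dimension.\<close>

definition minkowski_spectrum :: "'a::{field,finite} itself \<Rightarrow> 'd::finite itself \<Rightarrow> ereal set" where
  "minkowski_spectrum _ _ =
    minkowski_mu ` (unimodular_lattices :: ('a fls ^ 'd) set set)"

end

theory Submission
  imports Defs
begin

text \<open>
  Write \<open>q\<close> for the number of elements of the base field. Both halves of the statement rest on
  a normal form for plane lattices: Euclid's algorithm produces a basis \<open>a, b\<close> in which the diagonal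
  entries \<open>a $ 1\<close> and \<open>b $ 2\<close> strictly dominate the other entry of their row
  (\<open>exists_reduced_basis\<close>). The determinant then has the absolute value of the
  product of these two entries, which is therefore 1 for a unimodular lattice. Geometrically, the
  orbit of every plane lattice under diagonal matrices meets the compact part of the space of lattices.

  For the upper bound, a vector is reduced modulo the lattice by replacing its coefficients with
  respect to \<open>a, b\<close> by their fractional parts, which have absolute value at most \<open>1/q\<close>; the
  ultrametric inequality gives a remainder of product norm at most \<open>1/q\<^sup>2\<close>
  (\<open>exists_lattice_point_near\<close>).

  For the lower bound, scaling the coordinates turns the lattice into the set of pairs
  \<open>(p + r \<theta>, r + p \<phi>)\<close> with polynomials \<open>p, r\<close> and \<open>\<theta>, \<phi>\<close> of absolute value less than 1.
  Where one of the two forms is small, the other one has the absolute value of \<open>r\<close>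
  or of \<open>p\<close>, so the problem splits into two independent one-dimensional ones: given \<open>\<theta>\<close>,
  find \<open>\<nu>\<close> of absolute value \<open>1/q\<close> such that \<open>\<bar>r\<bar> \<bar>\<nu> - p - r \<theta>\<bar>\<close> is at least \<open>1/q\<^sup>2\<close> for
  all \<open>p\<close> and all nonzero \<open>r\<close> (\<open>exists_badly_approximable_shift\<close>). Dirichlet's theorem
  provides polynomials \<open>Q\<close> for which \<open>Q \<theta>\<close> is very close to a polynomial, and such
  a \<open>Q\<close> certifies the inequality as soon as the coefficient of \<open>1/x\<close> in \<open>Q \<nu>\<close> does not
  vanish. One \<open>Q\<close> in each degree suffices, so these conditions form a triangular system for the
  coefficients of \<open>\<nu>\<close>, which always has a solution.
\<close>

\<comment> \<open>Without this, \<open>$\<close> would be ambiguous between coefficients of power series and entries of vectors.\<close>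
unbundle no Formal_Power_Series.fps_syntax

section \<open>Polynomials inside the field of Laurent series\<close>

lemma embed_poly_0 [simp]: "embed_poly 0 = 0"
  by (simp add: embed_poly_def)

lemma embed_poly_add: "embed_poly (p + r) = embed_poly p + embed_poly r"
  by (rule fls_eqI) (simp add: embed_poly_nth)

lemma embed_poly_diff: "embed_poly (p - r) = embed_poly p - embed_poly r"
  by (rule fls_eqI) (simp add: embed_poly_nth)

lemma embed_poly_pCons:
  "embed_poly (pCons c p) = fls_const c + fls_X_inv * embed_poly p"
  by (simp add: embed_poly_def map_poly_pCons)

lemma embed_poly_smult: "embed_poly (smult c p) = fls_const c * embed_poly p"
  by (rule fls_eqI) (simp add: embed_poly_nth)

lemma embed_poly_mult: "embed_poly (p * r) = embed_poly p * embed_poly r"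
  by (induction p)
    (simp_all add: embed_poly_pCons embed_poly_add embed_poly_smult algebra_simps)

lemma fls_nth_embed_poly_times:
  "fls_nth (embed_poly p * f) k = (\<Sum>i\<le>degree p. coeff p i * fls_nth f (k + int i))"
proof -
  have deg: "degree (map_poly fls_const p) = degree p"
    by (rule degree_map_poly) auto
  have "embed_poly p * f = (\<Sum>i\<le>degree p. fls_const (coeff p i) * (fls_X_inv ^ i * f))"
    by (simp add: embed_poly_def poly_altdef deg coeff_map_poly sum_distrib_right mult.assoc)
  then show ?thesis
    by (simp add: fls_nth_sum fls_X_inv_power_times_conv_shift(1))
qed

lemma exists_polynomial_part:
  "\<exists>p. \<forall>k. fls_nth (f - embed_poly p) k = (if k \<le> 0 then 0 else fls_nth f k)"
proof -
  define N where "N = nat (- fls_subdegree f)"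
  define p where "p = (\<Sum>i\<le>N. monom (fls_nth f (- int i)) i)"
  have "coeff p i = fls_nth f (- int i)" for i
    by (auto simp: p_def coeff_sum N_def)
  then have "fls_nth (f - embed_poly p) k = (if k \<le> 0 then 0 else fls_nth f k)" for k
    by (simp add: embed_poly_nth)
  then show ?thesis by blast
qed

section \<open>The ultrametric absolute value\<close>

lemma card_field_ge_2: "real CARD('a::{field,finite}) \<ge> 2"
proof -
  have "card {0, 1 :: 'a} \<le> CARD('a)"
    by (intro card_mono) auto
  then show ?thesis by simp
qed

lemma fls_abs_0 [simp]: "fls_abs 0 = 0"
  by (simp add: fls_abs_def)

lemma fls_abs_1 [simp]: "fls_abs 1 = 1"
  by (simp add: fls_abs_def)

lemma fls_abs_nonneg [simp]: "fls_abs f \<ge> 0"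
  by (simp add: fls_abs_def)

lemma fls_abs_eq_0_iff [simp]: "fls_abs f = 0 \<longleftrightarrow> f = 0"
  by (simp add: fls_abs_def power_int_eq_0_iff)

lemma fls_abs_mult: "fls_abs (f * g) = fls_abs f * fls_abs g"
  by (simp add: fls_abs_def power_int_add [symmetric])

lemma fls_abs_uminus [simp]: "fls_abs (- f) = fls_abs f"
  by (simp add: fls_abs_def)

lemma fls_abs_minus_commute: "fls_abs (f - g) = fls_abs (g - f)"
  by (metis fls_abs_uminus minus_diff_eq)

lemma fls_abs_divide: "fls_abs (f / g) = fls_abs f / fls_abs g"
proof (cases "g = 0")
  case False
  then show ?thesis
    using fls_abs_mult [of "f / g" g] by (simp add: field_simps)
qed simp

lemma fls_abs_le_powi_iff:
  fixes f :: "'a::{field,finite} fls"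
  shows "fls_abs f \<le> real CARD('a) powi (- n) \<longleftrightarrow> (\<forall>k<n. fls_nth f k = 0)"
proof (cases "f = 0")
  case False
  have "fls_abs f \<le> real CARD('a) powi (- n) \<longleftrightarrow> n \<le> fls_subdegree f"
    using False power_int_increasing [of "- fls_subdegree f" "- n" "real CARD('a)"]
      power_int_strict_increasing [of "- n" "- fls_subdegree f" "real CARD('a)"]
      card_field_ge_2 [where 'a = 'a]
    by (simp add: fls_abs_def) linarith
  also have "\<dots> \<longleftrightarrow> (\<forall>k<n. fls_nth f k = 0)"
    using False by (meson fls_eq0_below_subdegree fls_subdegree_geI order_less_le_trans)
  finally show ?thesis .
qed simp

lemma fls_abs_less_powi_iff:
  fixes f :: "'a::{field,finite} fls"
  shows "fls_abs f < real CARD('a) powi (- n) \<longleftrightarrow> (\<forall>k\<le>n. fls_nth f k = 0)"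
proof -
  have "fls_abs f < real CARD('a) powi (- n) \<longleftrightarrow> fls_abs f \<le> real CARD('a) powi (- (n + 1))"
  proof (cases "f = 0")
    case False
    have "real CARD('a) powi (- fls_subdegree f) < real CARD('a) powi (- n) \<longleftrightarrow> n < fls_subdegree f"
      using power_int_increasing [of "- n" "- fls_subdegree f" "real CARD('a)"]
        power_int_strict_increasing [of "- fls_subdegree f" "- n" "real CARD('a)"]
        card_field_ge_2 [where 'a = 'a] by linarith
    moreover have "real CARD('a) powi (- fls_subdegree f) \<le> real CARD('a) powi (- (n + 1)) \<longleftrightarrow>
        n + 1 \<le> fls_subdegree f"
      using power_int_increasing [of "- fls_subdegree f" "- (n + 1)" "real CARD('a)"]
        power_int_strict_increasing [of "- (n + 1)" "- fls_subdegree f" "real CARD('a)"]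
        card_field_ge_2 [where 'a = 'a] by linarith
    ultimately show ?thesis
      using False by (simp add: fls_abs_def) linarith
  qed (use card_field_ge_2 [where 'a = 'a] in auto)
  then show ?thesis
    by (simp add: fls_abs_le_powi_iff del: minus_add_distrib)
qed

lemma fls_abs_less_1_iff: "fls_abs f < 1 \<longleftrightarrow> (\<forall>k\<le>0. fls_nth f k = 0)"
  using fls_abs_less_powi_iff [of f 0] by simp

lemma fls_abs_add_le_max: "fls_abs (f + g) \<le> max (fls_abs f) (fls_abs g)"
proof -
  have main: "fls_abs (f + g) \<le> fls_abs f"
    if "fls_abs g \<le> fls_abs f" "f \<noteq> 0" for f g :: "'a fls"
  proof -
    have "fls_abs f \<le> real CARD('a) powi (- fls_subdegree f)"
      using that by (simp add: fls_abs_def)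
    then have "fls_abs (f + g) \<le> real CARD('a) powi (- fls_subdegree f)"
      using that(1) order_trans unfolding fls_abs_le_powi_iff
      by (metis (no_types, lifting) add.right_neutral fls_abs_le_powi_iff fls_plus_nth)
    then show ?thesis using that by (simp add: fls_abs_def)
  qed
  show ?thesis
    using main [of g f] main [of f g]
    by (cases "f = 0"; cases "g = 0"; cases "fls_abs g \<le> fls_abs f") (auto simp: add.commute max_def)
qed

lemma fls_abs_diff_le_max: "fls_abs (f - g) \<le> max (fls_abs f) (fls_abs g)"
  using fls_abs_add_le_max [of f "- g"] by simp

lemma fls_abs_add_eq:
  assumes "fls_abs g < fls_abs f"
  shows "fls_abs (f + g) = fls_abs f"
  using fls_abs_add_le_max [of f g] fls_abs_diff_le_max [of "f + g" g] assms
  by simp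

lemma fls_abs_diff_eq:
  assumes "fls_abs g < fls_abs f"
  shows "fls_abs (f - g) = fls_abs f"
  using fls_abs_add_eq [of "- g" f] assms by simp

lemma fls_abs_embed_poly_ge_1: "p \<noteq> 0 \<Longrightarrow> fls_abs (embed_poly p) \<ge> 1"
  using card_field_ge_2 [where 'a = 'a]
  by (simp add: fls_abs_embed_poly one_le_power)

lemma exists_polynomial_near:
  fixes f :: "'a::{field,finite} fls"
  shows "\<exists>p. fls_abs (f - embed_poly p) < 1"
  using exists_polynomial_part [of f] unfolding fls_abs_less_1_iff by metis

lemma fls_abs_pos_iff: "fls_abs f > 0 \<longleftrightarrow> f \<noteq> 0"
  using fls_abs_nonneg [of f] fls_abs_eq_0_iff [of f] by linarith

text \<open>The value group consists of the powers of \<open>q\<close>, so strict inequalities gain a factor \<open>q\<close>.\<close>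

lemma fls_abs_less_imp_mult_le:
  fixes f g :: "'a::{field,finite} fls"
  assumes "fls_abs f < fls_abs g"
  shows "real CARD('a) * fls_abs f \<le> fls_abs g"
proof -
  let ?q = "real CARD('a)"
  have q: "?q \<ge> 2" by (rule card_field_ge_2)
  have "g \<noteq> 0"
    using assms by (metis fls_abs_0 fls_abs_nonneg not_less)
  then have g: "fls_abs g = ?q powi (- fls_subdegree g)"
    by (simp add: fls_abs_def)
  have "fls_abs f \<le> ?q powi (- (fls_subdegree g + 1))"
    using assms unfolding g fls_abs_less_powi_iff fls_abs_le_powi_iff by simp
  then have "?q * fls_abs f \<le> ?q powi 1 * ?q powi (- (fls_subdegree g + 1))"
    using q by simp
  also have "\<dots> = fls_abs g"
    unfolding g using q by (subst power_int_add [symmetric]) auto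
  finally show ?thesis .
qed

lemma fls_abs_less_1_imp_le:
  fixes f :: "'a::{field,finite} fls"
  assumes "fls_abs f < 1"
  shows "fls_abs f \<le> real CARD('a) powi (-1)"
  using fls_abs_less_imp_mult_le [of f 1] assms card_field_ge_2 [where 'a = 'a]
  by (simp add: power_int_minus field_simps)

section \<open>Inhomogeneous Diophantine approximation\<close>

lemma card_polys_degree_le:
  "card {p :: 'a::{field,finite} poly. degree p \<le> n} = CARD('a) ^ Suc n"
  and finite_polys_degree_le: "finite {p :: 'a poly. degree p \<le> n}"
proof -
  let ?L = "{xs :: 'a list. set xs \<subseteq> UNIV \<and> length xs = Suc n}"
  let ?f = "\<lambda>p :: 'a poly. map (coeff p) [0..<Suc n]"
  have bij: "bij_betw ?f {p. degree p \<le> n} ?L"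
  proof (rule bij_betw_byWitness [where f' = Poly])
    show "\<forall>p\<in>{p. degree p \<le> n}. Poly (?f p) = p"
      by (auto intro!: poly_eqI simp: nth_default_def coeff_eq_0 simp del: upt_Suc)
    show "\<forall>xs\<in>?L. ?f (Poly xs) = xs"
      by (auto intro!: nth_equalityI simp: nth_default_def simp del: upt_Suc)
    show "Poly ` ?L \<subseteq> {p. degree p \<le> n}"
      by (auto intro!: degree_le simp: nth_default_def)
  qed auto
  show "card {p :: 'a poly. degree p \<le> n} = CARD('a) ^ Suc n"
    using bij_betw_same_card [OF bij] card_lists_length_eq [of "UNIV :: 'a set" "Suc n"] by simp
  show "finite {p :: 'a poly. degree p \<le> n}"
    using bij_betw_finite [OF bij] finite_lists_length_eq [of "UNIV :: 'a set" "Suc n"] by simp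
qed

text \<open>
  Multiplication by \<open>P\<close> brings \<open>\<theta>\<close> within \<open>q\<close> to the \<open>- n - 1\<close> of a polynomial.
\<close>

definition dirichlet_multiplier :: "'a::{field,finite} fls \<Rightarrow> nat \<Rightarrow> 'a poly \<Rightarrow> bool" where
  "dirichlet_multiplier \<theta> n P \<longleftrightarrow> (\<forall>j\<in>{1..n}. fls_nth (embed_poly P * \<theta>) (int j) = 0)"

text \<open>
  Dirichlet's theorem. The \<open>n\<close> coefficients that have to vanish take at most \<open>q ^ n\<close> joint values,
  while there are \<open>q ^ (n + 1)\<close> polynomials of degree at most \<open>n\<close>; two of them collide, and
  their difference is the multiplier.
\<close>

lemma exists_dirichlet_multiplier:
  fixes \<theta> :: "'a::{field,finite} fls"
  shows "\<exists>P. P \<noteq> 0 \<and> degree P \<le> n \<and> dirichlet_multiplier \<theta> n P"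
proof -
  let ?D = "{p :: 'a poly. degree p \<le> n}"
  let ?f = "\<lambda>p. map (\<lambda>j. fls_nth (embed_poly p * \<theta>) (int j)) [1..<Suc n]"
  have "card (?f ` ?D) \<le> card {xs :: 'a list. set xs \<subseteq> UNIV \<and> length xs = n}"
    by (intro card_mono finite_lists_length_eq) auto
  also have "\<dots> = CARD('a) ^ n"
    by (rule card_lists_length_eq) simp
  also have "\<dots> < card ?D"
    using card_field_ge_2 [where 'a = 'a] unfolding card_polys_degree_le by simp
  finally have "\<not> inj_on ?f ?D"
    by (rule pigeonhole)
  then obtain p r where pr: "degree p \<le> n" "degree r \<le> n" "p \<noteq> r" "?f p = ?f r"
    unfolding inj_on_def by blast
  have "fls_nth (embed_poly p * \<theta>) (int j) = fls_nth (embed_poly r * \<theta>) (int j)"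
    if "j \<in> {1..n}" for j
    using pr(4) that unfolding map_eq_conv by (auto simp del: upt_Suc)
  then have "dirichlet_multiplier \<theta> n (p - r)"
    by (simp add: dirichlet_multiplier_def embed_poly_diff left_diff_distrib)
  moreover have "degree (p - r) \<le> n"
    using degree_diff_le [OF pr(1,2)] .
  ultimately show ?thesis
    using pr(3) by (intro exI [of _ "p - r"]) simp
qed

text \<open>
  In each degree a single polynomial does at least as well as all others, at every precision at
  once: there are only finitely many candidates, and if each of them were beaten at some precision,
  one that works at the largest of these precisions would be beaten by none.
\<close>

lemma exists_best_multiplier:
  fixes \<theta> :: "'a::{field,finite} fls"
  shows "\<exists>Q. Q \<noteq> 0 \<and> degree Q = d \<and>
    (\<forall>n P. P \<noteq> 0 \<longrightarrow> degree P = d \<longrightarrow> dirichlet_multiplier \<theta> n P \<longrightarrow> dirichlet_multiplier \<theta> n Q)"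
proof (rule ccontr)
  let ?A = "{Q :: 'a poly. Q \<noteq> 0 \<and> degree Q = d}"
  assume "\<not> ?thesis"
  then have "\<forall>Q\<in>?A. \<exists>n. (\<exists>P\<in>?A. dirichlet_multiplier \<theta> n P) \<and> \<not> dirichlet_multiplier \<theta> n Q"
    by blast
  then have "\<exists>m. \<forall>Q\<in>?A. (\<exists>P\<in>?A. dirichlet_multiplier \<theta> (m Q) P) \<and> \<not> dirichlet_multiplier \<theta> (m Q) Q"
    by (rule bchoice)
  then obtain m where m: "\<And>Q. Q \<in> ?A \<Longrightarrow> \<exists>P\<in>?A. dirichlet_multiplier \<theta> (m Q) P"
      "\<And>Q. Q \<in> ?A \<Longrightarrow> \<not> dirichlet_multiplier \<theta> (m Q) Q"
    by blast
  have fin: "finite ?A"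
    by (rule finite_subset [OF _ finite_polys_degree_le [of d]]) auto
  have "monom 1 d \<in> ?A"
    by (simp add: degree_monom_eq)
  then have "m ` ?A \<noteq> {}"
    by blast
  then have "Max (m ` ?A) \<in> m ` ?A"
    using fin by (intro Max_in finite_imageI)
  then obtain Q where "Q \<in> ?A" "Max (m ` ?A) = m Q"
    by (rule imageE)
  then obtain P where P: "P \<in> ?A" "dirichlet_multiplier \<theta> (Max (m ` ?A)) P"
    using m(1) [of Q] by metis
  have "m P \<le> Max (m ` ?A)"
    using fin P(1) by (intro Max_ge) auto
  then have "dirichlet_multiplier \<theta> (m P) P"
    using P(2) by (auto simp: dirichlet_multiplier_def)
  then show False using m(2) P(1) by blast
qed

text \<open>
  The residues (the coefficients of \<open>1/x\<close>) of the products \<open>Q d * \<nu>\<close> can be prescribed freely when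
  there is one \<open>Q d\<close> in each degree: they form a triangular linear system in the coefficients
  of \<open>\<nu>\<close>, with the nonzero leading coefficients on the diagonal.
\<close>

lemma exists_residues_eq_1:
  fixes Q :: "nat \<Rightarrow> 'a::{field,finite} poly"
  assumes Q: "\<And>d. Q d \<noteq> 0" "\<And>d. degree (Q d) = d"
  shows "\<exists>\<nu>. (\<forall>k\<le>0. fls_nth \<nu> k = 0) \<and> (\<forall>d. fls_nth (embed_poly (Q d) * \<nu>) 1 = 1)"
proof -
  have "\<exists>c. \<forall>d. (\<Sum>i<d. coeff (Q d) i * c i) + coeff (Q d) d * c d = 1"
  proof (rule dependent_wellorder_choice)
    fix d and f :: "nat \<Rightarrow> 'a"
    have nz: "coeff (Q d) d \<noteq> 0"
      using Q [of d] by (metis leading_coeff_0_iff)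
    show "\<exists>r. (\<Sum>i<d. coeff (Q d) i * f i) + coeff (Q d) d * r = 1"
      using nz by (intro exI [of _ "(1 - (\<Sum>i<d. coeff (Q d) i * f i)) / coeff (Q d) d"]) simp
  next
    fix r d and f g :: "nat \<Rightarrow> 'a"
    assume "\<And>i. i < d \<Longrightarrow> f i = g i"
    then have "(\<Sum>i<d. coeff (Q d) i * f i) = (\<Sum>i<d. coeff (Q d) i * g i)"
      by (intro sum.cong) auto
    then show "((\<Sum>i<d. coeff (Q d) i * f i) + coeff (Q d) d * r = 1) =
        ((\<Sum>i<d. coeff (Q d) i * g i) + coeff (Q d) d * r = 1)"
      by simp
  qed
  then obtain c where c: "\<And>d. (\<Sum>i<d. coeff (Q d) i * c i) + coeff (Q d) d * c d = 1"
    by blast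
  define \<nu> where "\<nu> = fls_shift (-1) (fps_to_fls (Abs_fps c))"
  have nth: "fls_nth \<nu> k = (if k \<le> 0 then 0 else c (nat (k - 1)))" for k
    by (auto simp: \<nu>_def)
  have "fls_nth (embed_poly (Q d) * \<nu>) 1 = (\<Sum>i\<le>d. coeff (Q d) i * c i)" for d
    by (simp add: fls_nth_embed_poly_times nth Q)
  also have "\<dots> d = 1" for d
    using c [of d] by (simp flip: lessThan_Suc_atMost)
  finally show ?thesis using nth by (intro exI [of _ \<nu>]) auto
qed

text \<open>
  Every \<open>\<theta>\<close> has a shift \<open>\<nu>\<close> that is badly approximable by the values of
  \<open>p + r * \<theta>\<close>. Let \<open>Q\<close> be a polynomial of degree at most \<open>k + 1\<close>, where \<open>k = degree r\<close>, such
  that \<open>Q * \<theta>\<close> is within \<open>q\<close> to the \<open>- k - 2\<close> of a polynomial. If \<open>\<nu>\<close> were within less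
  than \<open>q\<close> to the \<open>- k - 2\<close> of \<open>p + r * \<theta>\<close>, then multiplication by \<open>Q\<close> would put \<open>Q * \<nu>\<close>
  within less than \<open>1/q\<close> of a polynomial, so that its residue would vanish. Hence \<open>\<nu>\<close> works as
  soon as all residues of the products \<open>Q * \<nu>\<close> are nonzero. These conditions are compatible
  because the best multiplier of each degree supplies a \<open>Q\<close> for every \<open>k\<close>, so that only one
  condition per degree arises.
\<close>

lemma exists_badly_approximable_shift:
  fixes \<theta> :: "'a::{field,finite} fls"
  shows "\<exists>\<nu>. fls_abs \<nu> = real CARD('a) powi (-1) \<and>
    (\<forall>p r. r \<noteq> 0 \<longrightarrow>
      real CARD('a) powi (-2) \<le> fls_abs (embed_poly r) * fls_abs (\<nu> - (embed_poly p + embed_poly r * \<theta>)))"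
proof -
  let ?q = "real CARD('a)"
  have q: "?q \<ge> 2" by (rule card_field_ge_2)
  obtain Q :: "nat \<Rightarrow> 'a poly" where Q: "\<And>d. Q d \<noteq> 0" "\<And>d. degree (Q d) = d"
    and best: "\<And>d n P. P \<noteq> 0 \<Longrightarrow> degree P = d \<Longrightarrow> dirichlet_multiplier \<theta> n P \<Longrightarrow> dirichlet_multiplier \<theta> n (Q d)"
    using exists_best_multiplier [of _ \<theta>] by metis
  obtain \<nu> where \<nu>: "\<forall>k\<le>0. fls_nth \<nu> k = 0" "\<And>d. fls_nth (embed_poly (Q d) * \<nu>) 1 = 1"
    using exists_residues_eq_1 [of Q] Q by blast
  \<comment> \<open>\<open>Q 0\<close> is a nonzero constant, so its residue condition says that \<open>\<nu>\<close> has order exactly 1.\<close>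
  have "fls_nth \<nu> 1 \<noteq> 0"
    using \<nu>(2) [of 0] Q(2) [of 0] by (auto simp: fls_nth_embed_poly_times)
  then have "fls_subdegree \<nu> = 1"
    using \<nu>(1) by (intro fls_subdegree_eqI) auto
  moreover have "\<nu> \<noteq> 0" using \<open>fls_nth \<nu> 1 \<noteq> 0\<close> by auto
  ultimately have abs_\<nu>: "fls_abs \<nu> = ?q powi (-1)"
    by (simp add: fls_abs_def)
  have "?q powi (-2) \<le> fls_abs (embed_poly r) * fls_abs (\<nu> - (embed_poly p + embed_poly r * \<theta>))"
    if r: "r \<noteq> 0" for p r
  proof (rule ccontr)
    define k where "k = degree r"
    define \<delta> where "\<delta> = \<nu> - (embed_poly p + embed_poly r * \<theta>)"
    have abs_r: "fls_abs (embed_poly r) = ?q powi int k"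
      using fls_abs_embed_poly [OF r] by (simp add: k_def)
    assume "\<not> ?thesis"
    then have "fls_abs \<delta> * ?q powi int k < ?q powi (-2)"
      unfolding abs_r \<delta>_def by (simp only: not_le mult.commute)
    also have "?q powi (-2) = ?q powi (-2 - int k) * ?q powi int k"
      using q by (subst power_int_add [symmetric]) auto
    finally have \<delta>: "fls_abs \<delta> < ?q powi (-2 - int k)"
      using q by (subst (asm) mult_less_cancel_right_pos) auto
    obtain d where d: "d \<le> Suc k" "dirichlet_multiplier \<theta> (Suc k) (Q d)"
      using exists_dirichlet_multiplier [of "Suc k" \<theta>] best by blast
    obtain s where s: "\<And>j. fls_nth (embed_poly (Q d) * \<theta> - embed_poly s) j =
        (if j \<le> 0 then 0 else fls_nth (embed_poly (Q d) * \<theta>) j)"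
      using exists_polynomial_part by metis
    define \<epsilon> where "\<epsilon> = embed_poly (Q d) * \<theta> - embed_poly s"
    have "fls_nth \<epsilon> j = 0" if "j < int k + 2" for j
      using d(2) that unfolding \<epsilon>_def s dirichlet_multiplier_def
      by (auto dest!: bspec [of _ _ "nat j"])
    then have \<epsilon>: "fls_abs \<epsilon> \<le> ?q powi (- (int k + 2))"
      unfolding fls_abs_le_powi_iff by blast
    have "fls_abs (embed_poly (Q d) * \<delta>) < ?q powi (-1)"
    proof -
      have "fls_abs (embed_poly (Q d) * \<delta>) = ?q powi int d * fls_abs \<delta>"
        using fls_abs_embed_poly [OF Q(1) [of d]] Q(2) [of d] by (simp add: fls_abs_mult)
      also have "\<dots> < ?q powi int d * ?q powi (-2 - int k)"
        using \<delta> q by simp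
      also have "\<dots> = ?q powi (int d - 2 - int k)"
        using q by (subst power_int_add [symmetric]) (auto simp: algebra_simps)
      also have "\<dots> \<le> ?q powi (-1)"
        using q d(1) by (intro power_int_increasing) auto
      finally show ?thesis .
    qed
    moreover have "fls_abs (embed_poly r * \<epsilon>) < ?q powi (-1)"
    proof -
      have "fls_abs (embed_poly r * \<epsilon>) \<le> ?q powi int k * ?q powi (- (int k + 2))"
        unfolding fls_abs_mult abs_r using \<epsilon> q by (intro mult_left_mono) auto
      also have "\<dots> = ?q powi (-2)"
        using q by (subst power_int_add [symmetric]) auto
      also have "\<dots> < ?q powi (-1)"
        using q by (intro power_int_strict_increasing) auto
      finally show ?thesis .
    qed
    ultimately have "fls_abs (embed_poly (Q d) * \<delta> + embed_poly r * \<epsilon>) < ?q powi (-1)"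
      by (intro order_le_less_trans [OF fls_abs_add_le_max]) simp
    then have "fls_nth (embed_poly (Q d) * \<delta> + embed_poly r * \<epsilon>) 1 = 0"
      unfolding fls_abs_less_powi_iff by blast
    \<comment> \<open>Polynomials have no residue, so this residue is the one prescribed for \<open>Q d * \<nu>\<close>.\<close>
    moreover have "embed_poly (Q d) * \<delta> + embed_poly r * \<epsilon> =
        embed_poly (Q d) * \<nu> - embed_poly (Q d * p + r * s)"
      by (simp add: \<delta>_def \<epsilon>_def embed_poly_add embed_poly_mult algebra_simps)
    ultimately show False
      using \<nu>(2) [of d] by (simp add: embed_poly_nth)
  qed
  with abs_\<nu> show ?thesis by blast
qed

section \<open>Reduced bases of plane lattices\<close>

definition det2 :: "'a::field fls ^ 2 \<Rightarrow> 'a fls ^ 2 \<Rightarrow> 'a fls" where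
  "det2 a b = a $ 1 * b $ 2 - a $ 2 * b $ 1"

definition poly_span :: "'a::{field,finite} fls ^ 2 \<Rightarrow> 'a fls ^ 2 \<Rightarrow> ('a fls ^ 2) set" where
  "poly_span a b = {embed_poly p *s a + embed_poly r *s b | p r. True}"

lemma poly_span_commute: "poly_span a b = poly_span b a"
  unfolding poly_span_def by (metis add.commute)

lemma poly_span_diff: "poly_span (a - embed_poly s *s b) b = poly_span a b"
proof (intro equalityI subsetI)
  fix x assume "x \<in> poly_span (a - embed_poly s *s b) b"
  then obtain p r where "x = embed_poly p *s (a - embed_poly s *s b) + embed_poly r *s b"
    unfolding poly_span_def by blast
  then have "x = embed_poly p *s a + embed_poly (r - p * s) *s b"
    by (simp add: vec_eq_iff embed_poly_diff embed_poly_mult algebra_simps)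
  then show "x \<in> poly_span a b" unfolding poly_span_def by blast
next
  fix x assume "x \<in> poly_span a b"
  then obtain p r where "x = embed_poly p *s a + embed_poly r *s b"
    unfolding poly_span_def by blast
  then have "x = embed_poly p *s (a - embed_poly s *s b) + embed_poly (r + p * s) *s b"
    by (simp add: vec_eq_iff embed_poly_add embed_poly_mult algebra_simps)
  then show "x \<in> poly_span (a - embed_poly s *s b) b" unfolding poly_span_def by blast
qed

lemma det2_diff: "det2 (a - c *s b) b = det2 a b"
  by (simp add: det2_def algebra_simps)

lemma fls_abs_det2_commute: "fls_abs (det2 b a) = fls_abs (det2 a b)"
  unfolding det2_def by (subst fls_abs_minus_commute) (simp add: mult.commute)

text \<open>
  The matrix with columns \<open>a\<close> and \<open>b\<close> is strictly dominated, in each row, by its diagonal entry.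
  After scaling the two coordinates by \<open>a $ 1\<close> and \<open>b $ 2\<close> it becomes congruent to the identity
  modulo the maximal ideal of the ring of power series in \<open>1/x\<close>.
\<close>

definition reduced_pair :: "'a::{field,finite} fls ^ 2 \<Rightarrow> 'a fls ^ 2 \<Rightarrow> bool" where
  "reduced_pair a b \<longleftrightarrow> fls_abs (b $ 1) < fls_abs (a $ 1) \<and> fls_abs (a $ 2) < fls_abs (b $ 2)"

lemma exists_euclid_quotient:
  fixes a b :: "'a::{field,finite} fls ^ 'd::finite"
  assumes "b $ i \<noteq> 0"
  shows "\<exists>p. fls_abs ((a - embed_poly p *s b) $ i) < fls_abs (b $ i)"
proof -
  obtain p where "fls_abs (a $ i / b $ i - embed_poly p) < 1"
    using exists_polynomial_near by blast
  moreover have "(a - embed_poly p *s b) $ i = b $ i * (a $ i / b $ i - embed_poly p)"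
    using assms by (simp add: field_simps)
  moreover have "fls_abs (b $ i) > 0"
    using assms by (simp add: fls_abs_pos_iff)
  ultimately show ?thesis
    by (intro exI [of _ p]) (simp add: fls_abs_mult)
qed

text \<open>
  Euclid's algorithm in the first coordinate. Each division step passes from \<open>(a, b)\<close> to
  \<open>(b, c)\<close> with \<open>c = a - p b\<close> and makes the first coordinate of the second vector smaller. If
  the second coordinate has grown, \<open>(b, c)\<close> is reduced. Otherwise both coordinates of the second
  vector have not grown, the product of their absolute values has dropped by a factor \<open>q\<close>, and that
  of \<open>b\<close> still bounds the determinant; this can happen only finitely often. If the first coordinate
  of \<open>b\<close> vanishes, one division in the second coordinate finishes.
\<close>

lemma exists_reduced_basis_bounded:
  fixes a b :: "'a::{field,finite} fls ^ 2"
  assumes "det2 a b \<noteq> 0"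
    and "fls_abs (b $ 1) * fls_abs (b $ 2) < real CARD('a) ^ N * fls_abs (det2 a b)"
  shows "\<exists>a' b'. poly_span a' b' = poly_span a b \<and>
    fls_abs (det2 a' b') = fls_abs (det2 a b) \<and> reduced_pair a' b'"
  using assms
proof (induction N arbitrary: a b rule: less_induct)
  case (less N a b)
  show ?case
  proof (cases "b $ 1 = 0")
    case True
    with less.prems(1) have "a $ 1 \<noteq> 0" "b $ 2 \<noteq> 0"
      by (auto simp: det2_def)
    obtain p where p: "fls_abs ((a - embed_poly p *s b) $ 2) < fls_abs (b $ 2)"
      using exists_euclid_quotient \<open>b $ 2 \<noteq> 0\<close> by blast
    then have "reduced_pair (a - embed_poly p *s b) b"
      using True \<open>a $ 1 \<noteq> 0\<close> by (simp add: reduced_pair_def fls_abs_pos_iff)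
    then show ?thesis
      using poly_span_diff det2_diff by metis
  next
    case False
    obtain p where p: "fls_abs ((a - embed_poly p *s b) $ 1) < fls_abs (b $ 1)"
      using exists_euclid_quotient False by blast
    define c where "c = a - embed_poly p *s b"
    have span: "poly_span b c = poly_span a b"
      using poly_span_diff [of a p b] poly_span_commute by (metis c_def)
    have det: "fls_abs (det2 b c) = fls_abs (det2 a b)"
      using det2_diff [of a "embed_poly p" b] fls_abs_det2_commute by (metis c_def)
    show ?thesis
    proof (cases "fls_abs (b $ 2) < fls_abs (c $ 2)")
      case True
      then have "reduced_pair b c"
        using p by (simp add: reduced_pair_def c_def)
      then show ?thesis using span det by blast
    next
      case False
      have "fls_abs (det2 b c) \<le> max (fls_abs (b $ 1 * c $ 2)) (fls_abs (b $ 2 * c $ 1))"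
        unfolding det2_def by (rule fls_abs_diff_le_max)
      also have "\<dots> \<le> fls_abs (b $ 1) * fls_abs (b $ 2)"
        using p False by (auto simp: fls_abs_mult c_def [symmetric] mult.commute [of "fls_abs (b $ 2)"]
            intro!: mult_mono)
      finally have "fls_abs (det2 a b) \<le> fls_abs (b $ 1) * fls_abs (b $ 2)"
        by (simp add: det)
      with less.prems(2) have "N \<noteq> 0"
        by (cases N) auto
      then obtain M where M: "N = Suc M"
        using not0_implies_Suc by blast
      have "real CARD('a) * (fls_abs (c $ 1) * fls_abs (c $ 2)) \<le> fls_abs (b $ 1) * fls_abs (b $ 2)"
        using mult_mono [OF fls_abs_less_imp_mult_le [OF p] leI [OF False]]
        by (simp add: c_def mult.assoc)
      also have "\<dots> < real CARD('a) * (real CARD('a) ^ M * fls_abs (det2 b c))"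
        using less.prems(2) by (simp add: M det mult.assoc)
      finally have bound: "fls_abs (c $ 1) * fls_abs (c $ 2) < real CARD('a) ^ M * fls_abs (det2 b c)"
        using card_field_ge_2 [where 'a = 'a] by (subst (asm) mult_less_cancel_left_pos) auto
      have "det2 b c \<noteq> 0"
        using det less.prems(1) by (metis fls_abs_eq_0_iff)
      then show ?thesis
        using less.IH [OF _ _ bound] M span det by simp
    qed
  qed
qed

lemma exists_reduced_basis:
  fixes a b :: "'a::{field,finite} fls ^ 2"
  assumes "det2 a b \<noteq> 0"
  shows "\<exists>a' b'. poly_span a' b' = poly_span a b \<and>
    fls_abs (det2 a' b') = fls_abs (det2 a b) \<and> reduced_pair a' b'"
proof -
  have "fls_abs (det2 a b) > 0"
    using assms by (simp add: fls_abs_pos_iff)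
  moreover obtain N where
    "fls_abs (b $ 1) * fls_abs (b $ 2) / fls_abs (det2 a b) < real CARD('a) ^ N"
    using real_arch_pow card_field_ge_2 [where 'a = 'a] by (metis less_le_trans one_less_numeral_iff semiring_norm(76))
  ultimately show ?thesis
    using exists_reduced_basis_bounded [OF assms] by (simp add: pos_divide_less_eq)
qed

lemma fls_abs_det2_reduced:
  assumes "reduced_pair a b"
  shows "fls_abs (det2 a b) = fls_abs (a $ 1) * fls_abs (b $ 2)"
proof -
  have "fls_abs (a $ 2 * b $ 1) < fls_abs (a $ 1 * b $ 2)"
    unfolding fls_abs_mult mult.commute [of "fls_abs (a $ 2)"]
    using assms by (intro mult_strict_mono') (auto simp: reduced_pair_def)
  then show ?thesis
    unfolding det2_def by (simp add: fls_abs_diff_eq fls_abs_mult)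
qed

lemma unimodular_lattice_reduced_basis:
  fixes \<Lambda> :: "('a::{field,finite} fls ^ 2) set"
  assumes "\<Lambda> \<in> unimodular_lattices"
  shows "\<exists>a b. \<Lambda> = poly_span a b \<and> reduced_pair a b \<and> fls_abs (a $ 1) * fls_abs (b $ 2) = 1"
proof -
  obtain g :: "'a fls ^ 2 ^ 2" where g: "\<Lambda> = (\<lambda>w. g *v w) ` poly_vectors" "fls_abs (det g) = 1"
    using assms unfolding unimodular_lattices_def by blast
  define a b where "a = column 1 g" and "b = column 2 g"
  have mult: "g *v w = w $ 1 *s a + w $ 2 *s b" for w
    by (simp add: a_def b_def vec_eq_iff matrix_vector_mult_def column_def sum_2 mult.commute)
  have "\<Lambda> = poly_span a b"
  proof (intro equalityI subsetI)
    fix x assume "x \<in> \<Lambda>"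
    then obtain w :: "'a fls ^ 2" where w: "w \<in> poly_vectors" "x = w $ 1 *s a + w $ 2 *s b"
      unfolding g mult by blast
    then obtain p r where "w $ 1 = embed_poly p" "w $ 2 = embed_poly r"
      unfolding poly_vectors_def by blast
    with w show "x \<in> poly_span a b"
      unfolding poly_span_def by auto
  next
    fix x assume "x \<in> poly_span a b"
    then obtain p r where x: "x = embed_poly p *s a + embed_poly r *s b"
      unfolding poly_span_def by blast
    define w :: "'a fls ^ 2" where "w = (\<chi> i. if i = 1 then embed_poly p else embed_poly r)"
    have "w \<in> poly_vectors" "x = g *v w"
      by (auto simp: poly_vectors_def mult x w_def)
    then show "x \<in> \<Lambda>" using g by blast
  qed
  moreover have "fls_abs (det2 a b) = 1"
    using g(2) by (simp add: det_2 det2_def a_def b_def column_def mult.commute)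
  ultimately show ?thesis
    using exists_reduced_basis [of a b] fls_abs_det2_reduced
    by (metis fls_abs_eq_0_iff zero_neq_one)
qed

lemma prod_norm_2: "prod_norm (v :: 'a::{field,finite} fls ^ 2) = fls_abs (v $ 1) * fls_abs (v $ 2)"
  by (simp add: prod_norm_def UNIV_2)

section \<open>The upper bound\<close>

text \<open>
  Rounding both coefficients of \<open>v\<close> with respect to a reduced basis to their polynomial parts
  leaves an error whose two coordinates are at most \<open>fls_abs (a $ 1) / q\<close> and
  \<open>fls_abs (b $ 2) / q\<close>, by the ultrametric inequality.
\<close>

lemma exists_lattice_point_near:
  fixes a b v :: "'a::{field,finite} fls ^ 2"
  assumes red: "reduced_pair a b" and ab: "fls_abs (a $ 1) * fls_abs (b $ 2) = 1"
  shows "\<exists>u\<in>poly_span a b. prod_norm (v - u) \<le> real CARD('a) powi (-2)"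
proof -
  let ?q = "real CARD('a)"
  have D: "det2 a b \<noteq> 0"
    using fls_abs_det2_reduced [OF red] ab by (metis fls_abs_eq_0_iff zero_neq_one)
  define \<alpha> \<beta> where "\<alpha> = det2 v b / det2 a b" and "\<beta> = det2 a v / det2 a b"
  have v1: "v $ 1 = \<alpha> * a $ 1 + \<beta> * b $ 1" and v2: "v $ 2 = \<alpha> * a $ 2 + \<beta> * b $ 2"
    unfolding \<alpha>_def \<beta>_def times_divide_eq_left add_divide_distrib [symmetric]
    using D by (simp_all add: eq_divide_eq) (simp_all add: det2_def algebra_simps)
  obtain p where p: "fls_abs (\<alpha> - embed_poly p) < 1"
    using exists_polynomial_near by blast
  obtain r where r: "fls_abs (\<beta> - embed_poly r) < 1"
    using exists_polynomial_near by blast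
  define u where "u = embed_poly p *s a + embed_poly r *s b"
  have coord: "fls_abs ((\<alpha> - embed_poly p) * x + (\<beta> - embed_poly r) * y) \<le> ?q powi (-1) * m"
    if "fls_abs x \<le> m" "fls_abs y \<le> m" for x y m
  proof -
    have "fls_abs (\<alpha> - embed_poly p) * fls_abs x \<le> ?q powi (-1) * m"
      using fls_abs_less_1_imp_le [OF p] that by (intro mult_mono) auto
    moreover have "fls_abs (\<beta> - embed_poly r) * fls_abs y \<le> ?q powi (-1) * m"
      using fls_abs_less_1_imp_le [OF r] that by (intro mult_mono) auto
    ultimately show ?thesis
      by (intro order_trans [OF fls_abs_add_le_max]) (simp add: fls_abs_mult)
  qed
  have c1: "(v - u) $ 1 = (\<alpha> - embed_poly p) * a $ 1 + (\<beta> - embed_poly r) * b $ 1"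
    by (simp add: u_def v1 algebra_simps)
  have c2: "(v - u) $ 2 = (\<alpha> - embed_poly p) * a $ 2 + (\<beta> - embed_poly r) * b $ 2"
    by (simp add: u_def v2 algebra_simps)
  have "prod_norm (v - u) \<le> (?q powi (-1) * fls_abs (a $ 1)) * (?q powi (-1) * fls_abs (b $ 2))"
    unfolding prod_norm_2 c1 c2 using red
    by (intro mult_mono coord) (auto simp: reduced_pair_def)
  also have "\<dots> = ?q powi (-1) * ?q powi (-1) * (fls_abs (a $ 1) * fls_abs (b $ 2))"
    by (simp only: mult_ac)
  also have "\<dots> = ?q powi (-2)"
    unfolding ab using card_field_ge_2 [where 'a = 'a] by (subst power_int_add [symmetric]) auto
  finally show ?thesis
    unfolding poly_span_def u_def by blast
qed

section \<open>The lower bound\<close>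

text \<open>
  If the form \<open>p + r * \<theta>\<close> is small, then \<open>p\<close> is dominated by \<open>r\<close>. So the other form
  \<open>r + p * \<phi>\<close> has the absolute value of \<open>r\<close>, the shift \<open>\<eta>\<close> does not affect this, and
  the product is bounded below by the choice of \<open>\<nu>\<close>.
\<close>

lemma shifted_linear_form_bound:
  fixes \<theta> \<phi> \<nu> \<eta> :: "'a::{field,finite} fls"
  assumes \<nu>: "\<And>p r. r \<noteq> 0 \<Longrightarrow> real CARD('a) powi (-2)
      \<le> fls_abs (embed_poly r) * fls_abs (\<nu> - (embed_poly p + embed_poly r * \<theta>))"
    and small: "fls_abs \<theta> < 1" "fls_abs \<phi> < 1" "fls_abs \<eta> < 1"
    and near: "fls_abs (embed_poly p + embed_poly r * \<theta>) < 1" and nz: "p \<noteq> 0 \<or> r \<noteq> 0"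
  shows "real CARD('a) powi (-2) \<le> fls_abs (\<nu> - (embed_poly p + embed_poly r * \<theta>)) *
      fls_abs (\<eta> - (embed_poly r + embed_poly p * \<phi>))"
proof -
  have r: "r \<noteq> 0"
    using near nz fls_abs_embed_poly_ge_1 [of p] by auto
  then have r1: "fls_abs (embed_poly r) \<ge> 1"
    by (rule fls_abs_embed_poly_ge_1)
  have "fls_abs (embed_poly r * \<theta>) < fls_abs (embed_poly r)"
    using r1 small(1) by (simp add: fls_abs_mult)
  then have "fls_abs (embed_poly p) < fls_abs (embed_poly r) \<or> p = 0"
    using fls_abs_diff_le_max [of "embed_poly p + embed_poly r * \<theta>" "embed_poly r * \<theta>"] near r1
    by auto
  then have p: "fls_abs (embed_poly p) \<le> fls_abs (embed_poly r)"
    by auto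
  have "fls_abs (embed_poly p * \<phi>) \<le> fls_abs (embed_poly r) * fls_abs \<phi>"
    unfolding fls_abs_mult using p by (intro mult_right_mono) auto
  also have "\<dots> < fls_abs (embed_poly r)"
    using r1 small(2) by simp
  finally have u: "fls_abs (embed_poly r + embed_poly p * \<phi>) = fls_abs (embed_poly r)"
    by (rule fls_abs_add_eq)
  have "fls_abs (\<eta> - (embed_poly r + embed_poly p * \<phi>)) = fls_abs (embed_poly r)"
    using fls_abs_diff_eq [of \<eta> "embed_poly r + embed_poly p * \<phi>"] small(3) r1
      fls_abs_minus_commute u by (metis less_le_trans)
  then show ?thesis
    using \<nu> [OF r, of p] by (simp add: mult.commute)
qed

text \<open>
  After scaling the coordinates, the lattice points are the pairs
  \<open>(p + r * \<theta>, r + p * \<phi>)\<close> with \<open>\<theta>\<close> and \<open>\<phi>\<close> of absolute value less than 1. The point whose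
  coordinates are badly approximable shifts for \<open>\<theta>\<close> and \<open>\<phi>\<close> is far from all of them: at the
  origin the product is exactly \<open>1/q * 1/q\<close>, where one form is small the choice of the shift for that
  form applies, and where both forms are at least 1 the shifts are negligible.
\<close>

lemma exists_point_far_from_lattice:
  fixes a b :: "'a::{field,finite} fls ^ 2"
  assumes red: "reduced_pair a b" and ab: "fls_abs (a $ 1) * fls_abs (b $ 2) = 1"
  shows "\<exists>v. \<forall>u\<in>poly_span a b. real CARD('a) powi (-2) \<le> prod_norm (v - u)"
proof -
  let ?q = "real CARD('a)"
  have q: "?q \<ge> 2" by (rule card_field_ge_2)
  have nz: "a $ 1 \<noteq> 0" "b $ 2 \<noteq> 0"
    using ab by auto
  define \<theta> \<phi> where "\<theta> = b $ 1 / a $ 1" and "\<phi> = a $ 2 / b $ 2"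
  have small: "fls_abs \<theta> < 1" "fls_abs \<phi> < 1"
    using red nz
    by (simp_all add: \<theta>_def \<phi>_def fls_abs_divide reduced_pair_def fls_abs_pos_iff)
  obtain \<nu> where \<nu>: "fls_abs \<nu> = ?q powi (-1)" "\<And>p r. r \<noteq> 0 \<Longrightarrow> ?q powi (-2)
      \<le> fls_abs (embed_poly r) * fls_abs (\<nu> - (embed_poly p + embed_poly r * \<theta>))"
    using exists_badly_approximable_shift [of \<theta>] by blast
  obtain \<eta> where \<eta>: "fls_abs \<eta> = ?q powi (-1)" "\<And>p r. r \<noteq> 0 \<Longrightarrow> ?q powi (-2)
      \<le> fls_abs (embed_poly r) * fls_abs (\<eta> - (embed_poly p + embed_poly r * \<phi>))"
    using exists_badly_approximable_shift [of \<phi>] by blast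
  have less1: "fls_abs \<nu> < 1" "fls_abs \<eta> < 1"
    using q by (simp_all add: \<nu>(1) \<eta>(1) power_int_minus inverse_less_1_iff)
  have q2: "?q powi (-2) = ?q powi (-1) * ?q powi (-1)"
    using q by (subst power_int_add [symmetric]) auto
  have key: "?q powi (-2) \<le> fls_abs (\<nu> - (embed_poly p + embed_poly r * \<theta>)) *
      fls_abs (\<eta> - (embed_poly r + embed_poly p * \<phi>))" for p r
  proof -
    consider "p = 0" "r = 0"
      | "p \<noteq> 0 \<or> r \<noteq> 0" "fls_abs (embed_poly p + embed_poly r * \<theta>) < 1"
      | "p \<noteq> 0 \<or> r \<noteq> 0" "fls_abs (embed_poly r + embed_poly p * \<phi>) < 1"
      | "fls_abs (embed_poly p + embed_poly r * \<theta>) \<ge> 1" "fls_abs (embed_poly r + embed_poly p * \<phi>) \<ge> 1"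
      by force
    then show ?thesis
    proof cases
      case 1
      then show ?thesis by (simp add: \<nu>(1) \<eta>(1) q2)
    next
      case 2
      then show ?thesis
        using shifted_linear_form_bound [OF \<nu>(2) small less1(2)] by blast
    next
      case 3
      then show ?thesis
        using shifted_linear_form_bound [OF \<eta>(2) small(2,1) less1(1), of r p]
        by (simp add: mult.commute disj_commute)
    next
      case 4
      have far: "fls_abs (x - y) \<ge> 1" if "fls_abs x < 1" "fls_abs y \<ge> 1" for x y :: "'a fls"
        using fls_abs_diff_eq [of x y] that fls_abs_minus_commute [of x y] by simp
      have "?q powi (-2) \<le> ?q powi 0"
        using q by (intro power_int_increasing) auto
      also have "\<dots> \<le> fls_abs (\<nu> - (embed_poly p + embed_poly r * \<theta>)) *
          fls_abs (\<eta> - (embed_poly r + embed_poly p * \<phi>))"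
        using mult_mono [OF far [OF less1(1) 4(1)] far [OF less1(2) 4(2)]] by simp
      finally show ?thesis .
    qed
  qed
  define v :: "'a fls ^ 2" where "v = (\<chi> i. if i = 1 then a $ 1 * \<nu> else b $ 2 * \<eta>)"
  have "?q powi (-2) \<le> prod_norm (v - u)" if u_in: "u \<in> poly_span a b" for u
  proof -
    obtain p r where u: "u = embed_poly p *s a + embed_poly r *s b"
      using u_in unfolding poly_span_def by blast
    have "(v - u) $ 1 = a $ 1 * (\<nu> - (embed_poly p + embed_poly r * \<theta>))"
      using nz by (simp add: v_def u \<theta>_def algebra_simps)
    moreover have "(v - u) $ 2 = b $ 2 * (\<eta> - (embed_poly r + embed_poly p * \<phi>))"
      using nz by (simp add: v_def u \<phi>_def algebra_simps)
    ultimately have "prod_norm (v - u) = (fls_abs (a $ 1) * fls_abs (b $ 2)) *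
        (fls_abs (\<nu> - (embed_poly p + embed_poly r * \<theta>)) *
         fls_abs (\<eta> - (embed_poly r + embed_poly p * \<phi>)))"
      by (simp only: prod_norm_2 fls_abs_mult mult_ac)
    then show ?thesis
      using key [of p r] unfolding ab by simp
  qed
  then show ?thesis by blast
qed

section \<open>The Minkowski spectrum in dimension two\<close>

lemma minkowski_mu_unimodular:
  fixes \<Lambda> :: "('a::{field,finite} fls ^ 2) set"
  assumes "\<Lambda> \<in> unimodular_lattices"
  shows "minkowski_mu \<Lambda> = ereal (real CARD('a) powi (-2))"
proof -
  obtain a b where \<Lambda>: "\<Lambda> = poly_span a b"
    and red: "reduced_pair a b" "fls_abs (a $ 1) * fls_abs (b $ 2) = 1"
    using unimodular_lattice_reduced_basis [OF assms] by blast
  show ?thesis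
  proof (rule antisym)
    show "minkowski_mu \<Lambda> \<le> ereal (real CARD('a) powi (-2))"
      unfolding minkowski_mu_def \<Lambda>
    proof (rule SUP_least)
      fix v
      obtain u where "u \<in> poly_span a b" "prod_norm (v - u) \<le> real CARD('a) powi (-2)"
        using exists_lattice_point_near [OF red] by blast
      then show "(INF u\<in>poly_span a b. ereal (prod_norm (v - u))) \<le> ereal (real CARD('a) powi (-2))"
        by (intro INF_lower2) auto
    qed
    obtain v where "\<And>u. u \<in> poly_span a b \<Longrightarrow> real CARD('a) powi (-2) \<le> prod_norm (v - u)"
      using exists_point_far_from_lattice [OF red] by blast
    then have "ereal (real CARD('a) powi (-2)) \<le> (INF u\<in>poly_span a b. ereal (prod_norm (v - u)))"
      by (intro INF_greatest) simp
    also have "\<dots> \<le> minkowski_mu \<Lambda>"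
      unfolding minkowski_mu_def \<Lambda> by (intro SUP_upper) simp
    finally show "ereal (real CARD('a) powi (-2)) \<le> minkowski_mu \<Lambda>" .
  qed
qed

lemma poly_vectors_in_unimodular_lattices:
  "(poly_vectors :: ('a::{field,finite} fls ^ 'd::finite) set) \<in> unimodular_lattices"
  unfolding unimodular_lattices_def
  by (intro CollectI exI [of _ "mat 1"]) (simp add: invertible_def)

theorem theorem1p29:
  shows "minkowski_spectrum TYPE('a::{field,finite}) TYPE(2) = {ereal (real CARD('a) powi (-2))}
    \<and> (\<forall>\<Lambda> \<in> (unimodular_lattices :: ('a fls ^ 2) set set).
          minkowski_mu \<Lambda> = ereal (real CARD('a) powi (-2)))"
proof
  show mu: "\<forall>\<Lambda> \<in> (unimodular_lattices :: ('a fls ^ 2) set set).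
      minkowski_mu \<Lambda> = ereal (real CARD('a) powi (-2))"
    using minkowski_mu_unimodular by blast
  show "minkowski_spectrum TYPE('a) TYPE(2) = {ereal (real CARD('a) powi (-2))}"
    unfolding minkowski_spectrum_def
    using mu poly_vectors_in_unimodular_lattices [where 'a = 'a and 'd = 2] by (auto intro!: image_eqI)
qed

end
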